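(* Let $N=pq$ be a semiprime number with unknown prime factors $p$ and $q$, where $\nu_2(p-1)\neq\nu_2(q-1)$. There exists a deterministic polynomial-time reduction from solving the Quadratic Residuosity Problem modulo $N$ to $CRS(\nu_2(N-1)+1)$; i.e. there is a deterministic algorithm which, given $N$ and $a\in\mathbb{Z}$ with $\left(\frac{a}{N}\right)_2=1$, and oracle access to a procedure solving $CRS(\nu_2(N-1)+1)$, decides in time polynomial in $\log N$ whether $a$ is a quadratic residue modulo $N$ (i.e. whether there is $x\in\mathbb{Z}$ with $x^2\equiv a\pmod N$).
   Context: $\nu_2(n):=\max\{k\in\mathbb{N}_0: 2^k\mid n\}$. For $k\in\mathbb{N}_0$, a prime $p$ and $a\in\mathbb{Z}$ with $p\nmid a$, the rational $2^k$-th power residue symbol is $\left(\frac{a}{p}\right)_{2^k}=1$ if there is $x\in\mathbb{Z}$ with $x^{2^k}\equiv a \pmod p$, and $-1$ otherwise. For $n=p_1\cdots p_l$ a product of not necessarily distinct primes with $\gcd(n,a)=1$, set $\left(\frac{a}{n}\right)_{2^k}=\prod_{i=1}^l\left(\frac{a}{p_i}\right)_{2^k}$ (for $k=1$ this is the Jacobi-type symbol). For fixed $k\in\mathbb{N}$, the problem $CRS(k)$ is: given coprime $n,m\in\mathbb{N}$ such that $\left(\frac{m}{p}\right)_{2^{k-1}}=1$ for every prime factor $p$ of $n$, compute $\left(\frac{m}{n}\right)_{2^k}$. The Quadratic Residuosity Problem modulo $N=pq$ (distinct primes, unknown): given $a\in\mathbb{Z}$ with $\left(\frac{a}{N}\right)_2=1$,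 decide whether $a$ is a quadratic residue modulo $N$. A reduction to $CRS(k)$ is a polynomial-time algorithm using calls to an oracle for $CRS(k)$, each counted as one step.
   Formalization: For arbitrary integers a the running time is bounded by a polynomial in log N + log(1+|a|), since a must be read; the bound polynomial in log N alone is asserted for |a| < N. *)

theory Defs
  imports
    "HOL-Number_Theory.Number_Theory"
    "HOL-Computational_Algebra.Computational_Algebra"
    "HOL-Library.Log_Nat"
begin

section \<open>Rational power residue symbols\<close>

definition prime_symbol :: "nat \<Rightarrow> int \<Rightarrow> nat \<Rightarrow> int" where
  "prime_symbol k a p = (if \<exists>x::int. [x ^ (2 ^ k) = a] (mod int p) then 1 else -1)"

text \<open>The symbols are only meant for \<open>a\<close> coprime to \<open>p\<close> resp. \<open>n\<close> and for \<open>n > 0\<close>;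
  these side conditions are stated wherever the symbols are used.\<close>

definition res_symbol :: "nat \<Rightarrow> int \<Rightarrow> nat \<Rightarrow> int" where
  "res_symbol k a n = (\<Prod>p\<in>#prime_factorization n. prime_symbol k a p)"

text \<open>Here \<open>k \<ge> 1\<close> is intended. Nothing is assumed about the answers of the oracle on pairs that
  violate the promise.\<close>

definition CRS_instance :: "nat \<Rightarrow> nat \<Rightarrow> nat \<Rightarrow> bool" where
  "CRS_instance k n m \<longleftrightarrow>
     n > 0 \<and> m > 0 \<and> coprime n m \<and>
     (\<forall>p\<in>prime_factors n. prime_symbol (k - 1) (int m) p = 1)"

definition solves_CRS :: "nat \<Rightarrow> (nat \<Rightarrow> nat \<Rightarrow> int) \<Rightarrow> bool" where
  "solves_CRS k orc \<longleftrightarrow> (\<forall>n m. CRS_instance k n m \<longrightarrow> orc n m = res_symbol k (int m) n)"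


section \<open>Deterministic oracle programs with bit cost\<close>

text \<open>
  The machine model: while programs over finitely many integer registers, under the logarithmic
  (bit) cost criterion. Every instruction is charged, up to a constant factor, at least the number
  of bit operations a multitape Turing machine holding one register per tape needs for it:
  the schoolbook bound \<open>|u| * |v|\<close> for multiplication and division, and \<open>|u| + |v|\<close> for addition
  and subtraction, where \<open>|u|\<close> is the binary length. Hence polynomial time here is polynomial time
  in the usual sense. An oracle call is one step.
\<close>

type_synonym state = "nat \<Rightarrow> int"

datatype binop = OpAdd | OpSub | OpMul | OpDiv | OpMod

datatype com =
    Load nat int
  | Arith nat binop nat nat
  | Query nat nat nat
  | Seq com com
  | Cond nat com com
  | While nat com

text \<open>Binary length including a sign bit, so that every instruction costs at least 1.\<close>

definition bit_size :: "int \<Rightarrow> nat" where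
  "bit_size x = nat (bitlen \<bar>x\<bar>) + 1"

fun binop_val :: "binop \<Rightarrow> int \<Rightarrow> int \<Rightarrow> int" where
  "binop_val OpAdd u v = u + v"
| "binop_val OpSub u v = u - v"
| "binop_val OpMul u v = u * v"
| "binop_val OpDiv u v = u div v"
| "binop_val OpMod u v = u mod v"

fun binop_cost :: "binop \<Rightarrow> int \<Rightarrow> int \<Rightarrow> nat" where
  "binop_cost OpAdd u v = bit_size u + bit_size v"
| "binop_cost OpSub u v = bit_size u + bit_size v"
| "binop_cost OpMul u v = bit_size u * bit_size v"
| "binop_cost OpDiv u v = bit_size u * bit_size v"
| "binop_cost OpMod u v = bit_size u * bit_size v"

text \<open>\<open>exec orc c s t s'\<close>: with oracle \<open>orc\<close>, program \<open>c\<close> started in \<open>s\<close> halts in \<open>s'\<close> at total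
  cost \<open>t\<close>. Tests check whether a register is positive.\<close>

inductive exec :: "(nat \<Rightarrow> nat \<Rightarrow> int) \<Rightarrow> com \<Rightarrow> state \<Rightarrow> nat \<Rightarrow> state \<Rightarrow> bool"
  for orc :: "nat \<Rightarrow> nat \<Rightarrow> int"
where
  Load: "exec orc (Load x i) s (bit_size i) (s(x := i))"
| Arith: "exec orc (Arith x f y z) s (binop_cost f (s y) (s z)) (s(x := binop_val f (s y) (s z)))"
| Query: "exec orc (Query x y z) s 1 (s(x := orc (nat (s y)) (nat (s z))))"
| Seq: "exec orc c1 s t1 s1 \<Longrightarrow> exec orc c2 s1 t2 s2 \<Longrightarrow> exec orc (Seq c1 c2) s (t1 + t2) s2"
| CondTrue: "s x > 0 \<Longrightarrow> exec orc c1 s t s1 \<Longrightarrow>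
    exec orc (Cond x c1 c2) s (bit_size (s x) + t) s1"
| CondFalse: "\<not> s x > 0 \<Longrightarrow> exec orc c2 s t s1 \<Longrightarrow>
    exec orc (Cond x c1 c2) s (bit_size (s x) + t) s1"
| WhileFalse: "\<not> s x > 0 \<Longrightarrow> exec orc (While x c) s (bit_size (s x)) s"
| WhileTrue: "s x > 0 \<Longrightarrow> exec orc c s t1 s1 \<Longrightarrow> exec orc (While x c) s1 t2 s2 \<Longrightarrow>
    exec orc (While x c) s (bit_size (s x) + t1 + t2) s2"

inductive_cases exec_LoadE: "exec orc (Load x i) s t s'"
inductive_cases exec_ArithE: "exec orc (Arith x f y z) s t s'"
inductive_cases exec_QueryE: "exec orc (Query x y z) s t s'"
inductive_cases exec_SeqE: "exec orc (Seq c1 c2) s t s'"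
inductive_cases exec_CondE: "exec orc (Cond x c1 c2) s t s'"
inductive_cases exec_WhileE: "exec orc (While x c) s t s'"

lemma exec_deterministic:
  "exec orc c s t s1 \<Longrightarrow> exec orc c s t' s2 \<Longrightarrow> t' = t \<and> s2 = s1"
proof (induction arbitrary: t' s2 rule: exec.induct)
  case (Load x i s)
  then show ?case by (auto elim: exec_LoadE)
next
  case (Arith x f y z s)
  then show ?case by (auto elim: exec_ArithE)
next
  case (Query x y z s)
  then show ?case by (auto elim: exec_QueryE)
next
  case (Seq c1 s t1 s1 c2 t2 s2')
  from Seq.prems obtain u1 v u2 where "exec orc c1 s u1 v" "exec orc c2 v u2 s2" "t' = u1 + u2"
    by (rule exec_SeqE)
  with Seq.IH show ?case by metis
next
  case (CondTrue s x c1 t s1 c2)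
  from CondTrue.prems CondTrue.hyps obtain u where "exec orc c1 s u s2" "t' = bit_size (s x) + u"
    by - (erule exec_CondE; blast)
  with CondTrue.IH show ?case by metis
next
  case (CondFalse s x c2 t s1 c1)
  from CondFalse.prems CondFalse.hyps obtain u where "exec orc c2 s u s2" "t' = bit_size (s x) + u"
    by - (erule exec_CondE; blast)
  with CondFalse.IH show ?case by metis
next
  case (WhileFalse s x c)
  from WhileFalse.prems WhileFalse.hyps show ?case
    by - (erule exec_WhileE; blast)
next
  case (WhileTrue s x c t1 s1 t2 s2')
  from WhileTrue.prems WhileTrue.hyps(1) obtain u1 v u2
    where "exec orc c s u1 v" "exec orc (While x c) v u2 s2" "t' = bit_size (s x) + u1 + u2"
    by - (erule exec_WhileE; blast)
  with WhileTrue.IH show ?case by metis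
qed

text \<open>Inputs are in registers 0 and 1, all other registers are 0; the answer is in register 0.\<close>

definition input_state :: "nat \<Rightarrow> int \<Rightarrow> state" where
  "input_state N a = (\<lambda>_. 0)(0 := int N, 1 := a)"

end

theory Submission
  imports Defs
begin

text \<open>
  Let \<open>s = \<nu>\<^sub>2(p - 1) < \<nu>\<^sub>2(q - 1)\<close>. Then \<open>\<nu>\<^sub>2(N - 1) = s\<close>, so \<open>s\<close> can be computed from \<open>N\<close>, and
  \<open>m = a^(2^s)\<close> is a \<open>2^s\<close>-th power modulo both primes. Modulo \<open>p\<close> every \<open>2^s\<close>-th power is a
  \<open>2^(s+1)\<close>-th power, because \<open>(p - 1) / 2^s\<close> is odd; modulo \<open>q\<close>, Euler's criterion shows that \<open>m\<close> is a
  \<open>2^(s+1)\<close>-th power iff \<open>a\<close> is a square. Hence the single oracle answer for \<open>(N, m)\<close> is the Legendre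
  symbol of \<open>a\<close> modulo \<open>q\<close>, which decides the problem since both Legendre symbols of \<open>a\<close> agree.
  The element \<open>m mod N\<close> is found by squaring once for each halving of \<open>N - 1\<close>.
\<close>

section \<open>Power residues\<close>

lemma fermat_theorem_int:
  fixes a :: int
  assumes "prime p" "coprime a (int p)"
  shows "[a ^ (p - 1) = 1] (mod int p)"
proof -
  define b where "b = nat (a mod int p)"
  have p: "p > 0" using assms(1) prime_gt_0_nat by blast
  have b: "int b = a mod int p" using p by (simp add: b_def)
  then have ab: "[int b = a] (mod int p)" by simp
  have "coprime (int b) (int p)"
    using assms(2) ab cong_imp_coprime cong_sym by blast
  then have "\<not> p dvd b"
    using assms(1) by (metis coprime_absorb_right coprime_int_iff not_prime_unit)
  then have "[int b ^ (p - 1) = 1] (mod int p)"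
    using fermat_theorem[OF assms(1)] by (metis cong_int_iff of_nat_1 of_nat_power)
  then show ?thesis
    using ab cong_pow cong_sym cong_trans by blast
qed

lemma prime_symbol_cong:
  assumes "[a = b] (mod int p)"
  shows "prime_symbol k a p = prime_symbol k b p"
  unfolding prime_symbol_def using assms cong_trans cong_sym by meson

lemma prime_symbol_power_self [simp]: "prime_symbol k (a ^ (2 ^ k)) p = 1"
  unfolding prime_symbol_def using cong_refl by metis

lemma prime_symbol_1_iff_QuadRes: "prime_symbol 1 a p = 1 \<longleftrightarrow> QuadRes (int p) a"
  by (simp add: prime_symbol_def QuadRes_def)

lemma prime_symbol_cases: "prime_symbol k a p = 1 \<or> prime_symbol k a p = -1"
  by (simp add: prime_symbol_def)

text \<open>With \<open>d = 2 * c + 1\<close>, multiplying by \<open>a ^ (p - 1)\<close>, which is 1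
  modulo \<open>p\<close>, raises the exponent \<open>2 ^ s\<close> to
  \<open>2 ^ s * (d + 1) = 2 ^ Suc s * (c + 1)\<close>. So \<open>a ^ (c + 1)\<close> is an explicit
  root.\<close>

lemma prime_symbol_Suc_power_odd:
  assumes "prime p" "p - 1 = 2 ^ s * d" "odd d" "coprime a (int p)"
  shows "prime_symbol (Suc s) (a ^ (2 ^ s)) p = 1"
proof -
  obtain c where c: "d = 2 * c + 1" using assms(3) oddE by blast
  have "(a ^ (c + 1)) ^ (2 ^ Suc s) = a ^ (p - 1) * a ^ (2 ^ s)"
    unfolding assms(2) c power_mult[symmetric] power_add[symmetric] by (simp add: algebra_simps)
  moreover have "[a ^ (p - 1) * a ^ (2 ^ s) = 1 * a ^ (2 ^ s)] (mod int p)"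
    using fermat_theorem_int[OF assms(1,4)] by (rule cong_mult) simp
  ultimately have "[(a ^ (c + 1)) ^ (2 ^ Suc s) = a ^ (2 ^ s)] (mod int p)" by simp
  then show ?thesis unfolding prime_symbol_def by metis
qed

text \<open>If \<open>y ^ (2 ^ Suc s)\<close> is congruent to \<open>a ^ (2 ^ s)\<close>, raising
  both to the power \<open>e\<close> turns them into \<open>y ^ (q - 1)\<close> and
  \<open>a ^ ((q - 1) div 2)\<close>, so Euler's criterion applies to \<open>a\<close>. Conversely,
  a square root of \<open>a\<close> is itself the required root.\<close>

lemma prime_symbol_Suc_power:
  assumes "prime q" "q - 1 = 2 ^ Suc s * e" "coprime a (int q)"
  shows "prime_symbol (Suc s) (a ^ (2 ^ s)) q = prime_symbol 1 a q"
proof -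
  have q2: "q > 2"
  proof -
    \<comment> \<open>Since \<open>2 ^ Suc s\<close> divides \<open>q - 1\<close>, the prime is odd,
      as Euler's criterion demands.\<close>
    have "q \<noteq> 2" using assms(2) by (auto simp: mult.assoc)
    then show ?thesis using prime_ge_2_nat[OF assms(1)] by simp
  qed
  have nz: "\<not> [a = 0] (mod int q)"
    using assms(1,3) by (metis cong_0_iff coprime_absorb_right int_dvd_int_iff not_prime_unit
        of_nat_1 zdvd1_eq abs_of_nat nat_int nat_1 prime_nat_int_transfer)
  have "QuadRes (int q) a" if y: "[y ^ (2 ^ Suc s) = a ^ (2 ^ s)] (mod int q)" for y
  proof -
    have "coprime (y ^ (2 ^ Suc s)) (int q)"
      using assms(3) y by (metis cong_imp_coprime cong_sym coprime_power_left_iff)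
    then have cy: "coprime y (int q)" by simp
    have "a ^ ((q - 1) div 2) = (a ^ (2 ^ s)) ^ e"
      unfolding assms(2) power_mult[symmetric] by simp
    moreover have "[(a ^ (2 ^ s)) ^ e = (y ^ (2 ^ Suc s)) ^ e] (mod int q)"
      using y cong_pow cong_sym by blast
    moreover have "(y ^ (2 ^ Suc s)) ^ e = y ^ (q - 1)"
      unfolding assms(2) power_mult[symmetric] by simp
    ultimately have "[a ^ ((q - 1) div 2) = 1] (mod int q)"
      using fermat_theorem_int[OF assms(1) cy] cong_trans by metis
    then have "[Legendre a (int q) = 1] (mod int q)"
      using euler_criterion[OF assms(1) q2] cong_trans by blast
    \<comment> \<open>Of the three Legendre values, 0 is excluded by \<open>nz\<close> and -1 by
      this.\<close>
    moreover have "\<not> [-1 = 1] (mod int q)"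
    proof
      assume "[-1 = 1] (mod int q)"
      then have "int q dvd 2" by (simp add: cong_iff_dvd_diff)
      then show False using q2 zdvd_imp_le[of "int q" 2] by simp
    qed
    ultimately show ?thesis using nz by (auto simp: Legendre_def split: if_splits)
  qed
  moreover have "\<exists>y. [y ^ (2 ^ Suc s) = a ^ (2 ^ s)] (mod int q)" if res: "QuadRes (int q) a"
  proof -
    obtain x where "[x ^ 2 = a] (mod int q)" using res by (auto simp: QuadRes_def)
    then have "[(x ^ 2) ^ (2 ^ s) = a ^ (2 ^ s)] (mod int q)" by (rule cong_pow)
    then show ?thesis by (metis power_Suc power_mult)
  qed
  ultimately show ?thesis
    using prime_symbol_1_iff_QuadRes[of a q] prime_symbol_cases[of 1 a q]
    unfolding prime_symbol_def[of "Suc s"] by auto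
qed

section \<open>Symbols and residuosity modulo a product of two primes\<close>

lemma res_symbol_semiprime:
  assumes "prime p" "prime q"
  shows "res_symbol k a (p * q) = prime_symbol k a p * prime_symbol k a q"
  using assms by (simp add: res_symbol_def prime_factorization_mult prime_factorization_prime)

text \<open>Allows the oracle to be asked about the residue of \<open>a ^ (2 ^ s)\<close> instead of
  the power itself, whose length grows with \<open>2 ^ s\<close>.\<close>

lemma res_symbol_cong:
  assumes "[a = b] (mod int n)"
  shows "res_symbol k a n = res_symbol k b n"
proof -
  have "prime_symbol k a p = prime_symbol k b p" if "p \<in># prime_factorization n" for p
    using that assms by (intro prime_symbol_cong) (meson cong_dvd_modulus in_prime_factors_imp_dvd
        int_dvd_int_iff)
  then show ?thesis unfolding res_symbol_def by (metis (no_types, lifting) image_mset_cong)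
qed

lemma QuadRes_semiprime_iff:
  assumes "coprime p q"
  shows "QuadRes (int (p * q)) a \<longleftrightarrow> QuadRes (int p) a \<and> QuadRes (int q) a"
proof
  assume "QuadRes (int (p * q)) a"
  then show "QuadRes (int p) a \<and> QuadRes (int q) a"
    unfolding QuadRes_def of_nat_mult by (meson cong_dvd_modulus dvd_triv_left dvd_triv_right)
next
  assume "QuadRes (int p) a \<and> QuadRes (int q) a"
  then obtain x y where xy: "[x ^ 2 = a] (mod int p)" "[y ^ 2 = a] (mod int q)"
    by (auto simp: QuadRes_def)
  have cop: "coprime (int p) (int q)" using assms by simp
  obtain z where "[z = x] (mod int p)" "[z = y] (mod int q)"
    using binary_chinese_remainder_int[OF cop] by blast
  then have "[z ^ 2 = a] (mod int p)" "[z ^ 2 = a] (mod int q)"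
    using xy cong_pow cong_trans by blast+
  then show "QuadRes (int (p * q)) a"
    using coprime_cong_mult[OF _ _ cop] unfolding QuadRes_def of_nat_mult by blast
qed

text \<open>Expanding \<open>(2 ^ s * d + 1) * (2 ^ Suc s * e + 1) - 1\<close> leaves
  \<open>2 ^ s\<close> times a number of the same parity as \<open>d\<close>, which is odd. Thus
  \<open>s\<close> is read off from the product without its factors.\<close>

lemma multiplicity_semiprime_minus_one:
  assumes "p > 1" "q > 1" "multiplicity 2 (p - 1) < multiplicity 2 (q - 1)"
  shows "multiplicity 2 (p * q - 1) = multiplicity 2 (p - (1::nat))"
proof -
  define s where "s = multiplicity 2 (p - 1)"
  obtain d where d: "p - 1 = 2 ^ s * d" "odd d"
    using multiplicity_decompose'[of "p - 1" 2] assms(1) unfolding s_def by auto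
  have "2 ^ Suc s dvd q - 1" using assms(3) unfolding s_def by (intro multiplicity_dvd') simp
  then obtain e where e: "q - 1 = 2 ^ Suc s * e" by (elim dvdE)
  have p: "p = 2 ^ s * d + 1" and q: "q = 2 ^ Suc s * e + 1" using d e assms(1,2) by linarith+
  have "p * q - 1 = 2 ^ s * (d + 2 * (e + 2 ^ s * d * e))"
    unfolding p q by (simp add: algebra_simps)
  moreover have "odd (d + 2 * (e + 2 ^ s * d * e))" using d(2) by simp
  ultimately show ?thesis
    unfolding s_def[symmetric] by (intro multiplicity_eqI) (auto simp: mult.commute)
qed

lemma CRS_answer_iff_QuadRes:
  assumes "prime p" "prime q" "multiplicity 2 (p - 1) < multiplicity 2 (q - 1)"
    and "coprime a (int (p * q))" "res_symbol 1 a (p * q) = 1"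
    and s: "s = multiplicity 2 (p * q - 1)"
  shows "res_symbol (Suc s) (a ^ (2 ^ s)) (p * q) = (if QuadRes (int (p * q)) a then 1 else -1)"
proof -
  have gt: "p > 1" "q > 1" using assms(1,2) prime_gt_1_nat by auto
  have s': "s = multiplicity 2 (p - 1)"
    using multiplicity_semiprime_minus_one[OF gt assms(3)] s by simp
  obtain d where d: "p - 1 = 2 ^ s * d" "odd d"
    using multiplicity_decompose'[of "p - 1" 2] gt unfolding s' by auto
  have "2 ^ Suc s dvd q - 1" using assms(3) unfolding s' by (intro multiplicity_dvd') simp
  then obtain e where e: "q - 1 = 2 ^ Suc s * e" by (elim dvdE)
  have cop: "coprime a (int p)" "coprime a (int q)" using assms(4) by auto
  \<comment> \<open>The different 2-adic valuations make the primes distinct, so square roots can be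
    glued by the Chinese remainder theorem.\<close>
  have "p \<noteq> q" using assms(3) by auto
  then have "coprime p q" using assms(1,2) primes_coprime by blast
  then have "QuadRes (int (p * q)) a \<longleftrightarrow> prime_symbol 1 a p = 1 \<and> prime_symbol 1 a q = 1"
    by (simp only: QuadRes_semiprime_iff prime_symbol_1_iff_QuadRes)
  moreover have "prime_symbol 1 a p * prime_symbol 1 a q = 1"
    using assms(5) res_symbol_semiprime[OF assms(1,2)] by simp
  moreover have "res_symbol (Suc s) (a ^ (2 ^ s)) (p * q) = prime_symbol 1 a q"
    unfolding res_symbol_semiprime[OF assms(1,2)] prime_symbol_Suc_power_odd[OF assms(1) d cop(1)]
      prime_symbol_Suc_power[OF assms(2) e cop(2)] by simp
  ultimately show ?thesis
    using prime_symbol_cases[of 1 a p] prime_symbol_cases[of 1 a q] by auto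
qed

section \<open>The program and its cost\<close>

lemma bit_size_mono: "\<bar>x\<bar> \<le> \<bar>y\<bar> \<Longrightarrow> bit_size x \<le> bit_size y"
  unfolding bit_size_def bitlen_def by (auto intro!: floorlog_mono nat_mono)

lemma bit_size_ge_1: "bit_size x \<ge> 1"
  by (simp add: bit_size_def)

lemma bit_size_le_2: "\<bar>x\<bar> \<le> 1 \<Longrightarrow> bit_size x \<le> 2"
  using bit_size_mono[of x 1] by (simp add: bit_size_def bitlen_def floorlog_def)

text \<open>Without its sign bit, \<open>bit_size x\<close> is the least \<open>w\<close> with
  \<bar>x\<bar> < 2^w; this bound and the next one are the two halves of that fact.\<close>

lemma abs_less_power_bit_size: "\<bar>x\<bar> < 2 ^ (bit_size x - 1)"
  using bitlen_le_iff_power[of "\<bar>x\<bar>" "bitlen \<bar>x\<bar>"] by (simp add: bit_size_def)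

lemma bit_size_le: "\<bar>x\<bar> < 2 ^ w \<Longrightarrow> bit_size x \<le> Suc w"
  using bitlen_le_iff_power[of "\<bar>x\<bar>" "int w"] by (simp add: bit_size_def)

lemma bit_size_mult: "bit_size (x * y) \<le> bit_size x + bit_size y"
proof -
  have "\<bar>x * y\<bar> \<le> \<bar>x\<bar> * 2 ^ (bit_size y - 1)"
    unfolding abs_mult using abs_less_power_bit_size[of y] by (intro mult_left_mono) auto
  also have "\<dots> < 2 ^ (bit_size x - 1) * 2 ^ (bit_size y - 1)"
    using abs_less_power_bit_size[of x] by simp
  finally have "\<bar>x * y\<bar> < 2 ^ (bit_size x - 1 + (bit_size y - 1))" by (simp add: power_add)
  from bit_size_le[OF this] show ?thesis using bit_size_ge_1[of x] bit_size_ge_1[of y] by linarith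
qed

text \<open>The 2 accounts for the rounding in the binary length and for the sign bit; the 1 inside
  the logarithm covers \<open>x = 0\<close>.\<close>

lemma bit_size_le_log: "real (bit_size x) \<le> log 2 (1 + \<bar>real_of_int x\<bar>) + 2"
proof (cases "x = 0")
  case False
  then have "real_of_int \<lfloor>log 2 \<bar>real_of_int x\<bar>\<rfloor> \<le> log 2 (1 + \<bar>real_of_int x\<bar>)"
    by (intro order_trans[OF of_int_floor_le]) (simp add: log_mono)
  moreover have "real (nat (bitlen \<bar>x\<bar>)) = real_of_int (bitlen \<bar>x\<bar>)"
    using bitlen_nonneg by simp
  ultimately show ?thesis using False by (simp add: bit_size_def bitlen_alt_def)
qed (simp add: bit_size_def)

lemma bit_size_le_log': "n > 0 \<Longrightarrow> real (bit_size (int n)) \<le> log 2 (real n) + 2"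
  unfolding bit_size_def bitlen_alt_def by (simp add: of_nat_nat)

section \<open>Execution and running time of the program\<close>

lemma exec_iff:
  "exec orc (Load x i) s t s' \<longleftrightarrow> t = bit_size i \<and> s' = s(x := i)"
  "exec orc (Arith x f y z) s t s' \<longleftrightarrow>
     t = binop_cost f (s y) (s z) \<and> s' = s(x := binop_val f (s y) (s z))"
  "exec orc (Query x y z) s t s' \<longleftrightarrow> t = 1 \<and> s' = s(x := orc (nat (s y)) (nat (s z)))"
  "exec orc (Seq c1 c2) s t s' \<longleftrightarrow>
     (\<exists>t1 s1 t2. exec orc c1 s t1 s1 \<and> exec orc c2 s1 t2 s' \<and> t = t1 + t2)"
  "exec orc (Cond x c1 c2) s t s' \<longleftrightarrow>
     (\<exists>t1. exec orc (if s x > 0 then c1 else c2) s t1 s' \<and> t = bit_size (s x) + t1)"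
  by (auto elim: exec_LoadE exec_ArithE exec_QueryE exec_CondE intro: exec.intros
      exec.Query[unfolded One_nat_def]) (blast elim: exec_SeqE)

text \<open>Registers 2 and 3 hold the constants 2 and 1; register 5 is positive iff register 4, which
  starts as \<open>N - 1\<close>, is even.\<close>

definition square_body :: com where
  "square_body =
     Seq (Arith 1 OpMul 1 1) (Seq (Arith 1 OpMod 1 0) (Seq (Arith 4 OpDiv 4 2)
       (Seq (Arith 5 OpMod 4 2) (Arith 5 OpSub 3 5))))"

text \<open>Reducing \<open>a\<close> first puts register 1 into the range from 0 to
  \<open>N - 1\<close>, also for negative \<open>a\<close>, as the loop analysis requires.\<close>

definition setup_regs :: com where
  "setup_regs =
     Seq (Load 2 2) (Seq (Load 3 1) (Seq (Arith 4 OpSub 0 3) (Seq (Arith 1 OpMod 1 0)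
       (Seq (Arith 5 OpMod 4 2) (Arith 5 OpSub 3 5)))))"

text \<open>After the loop, register 5 is reused for the oracle answer; the test for positivity
  turns 1 into 1 and -1 into 0.\<close>

definition reduction :: com where
  "reduction = Seq setup_regs (Seq (While 5 square_body)
     (Seq (Query 5 0 1) (Cond 5 (Load 0 1) (Load 0 0))))"

lemma exec_square_body:
  assumes "0 \<le> s 4" "s 4 \<le> s 0" "0 \<le> s 1" "s 1 < s 0" "s 2 = 2" "s 3 = 1"
  shows "\<exists>t. exec orc square_body s t
      (s(1 := s 1 * s 1 mod s 0, 4 := s 4 div 2, 5 := 1 - s 4 div 2 mod 2)) \<and>
    t \<le> 13 * bit_size (s 0) ^ 2"
proof -
  define B where "B = bit_size (s 0)"
  have B1: "B \<ge> 1" unfolding B_def by (rule bit_size_ge_1)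
  have b1: "bit_size (s 1) \<le> B" unfolding B_def using assms by (intro bit_size_mono) auto
  have b4: "bit_size (s 4) \<le> B" unfolding B_def using assms by (intro bit_size_mono) auto
  have b4': "bit_size (s 4 div 2) \<le> B"
    unfolding B_def using assms by (intro bit_size_mono) auto
  have b5: "bit_size (s 4 div 2 mod 2) \<le> 2" by (intro bit_size_le_2) auto
  have two: "bit_size 2 = 3" by (simp add: bit_size_def bitlen_def floorlog_def)
  have one: "bit_size 1 = 2" by (simp add: bit_size_def bitlen_def floorlog_def)
  \<comment> \<open>The summands are the costs of the five instructions in order; 3 and 2 are the
    lengths of the constants 2 and 1.\<close>
  define t where "t = bit_size (s 1) * bit_size (s 1) + (bit_size (s 1 * s 1) * B
     + (bit_size (s 4) * 3 + (bit_size (s 4 div 2) * 3 + (2 + bit_size (s 4 div 2 mod 2)))))"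
  have "exec orc square_body s t
      (s(1 := s 1 * s 1 mod s 0, 4 := s 4 div 2, 5 := 1 - s 4 div 2 mod 2))"
    unfolding square_body_def t_def
    using assms two one by (simp add: exec_iff B_def fun_upd_twist del: One_nat_def)
  \<comment> \<open>13 = 1 + 2 + 3 + 3 + 4, one term per instruction; the square has length at most
    \<open>2 * B\<close> before its reduction.\<close>
  moreover have "t \<le> 13 * B ^ 2"
  proof -
    have "bit_size (s 1) * bit_size (s 1) \<le> B * B" using b1 by (intro mult_mono) auto
    moreover have "bit_size (s 1 * s 1) * B \<le> (B + B) * B"
      using bit_size_mult[of "s 1" "s 1"] b1 by (intro mult_mono) auto
    moreover have "B \<le> B * B" "1 \<le> B * B" using B1 by auto
    ultimately show ?thesis
      using b4 b4' b5 unfolding t_def power2_eq_square distrib_right by linarith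
  qed
  ultimately show ?thesis unfolding B_def by blast
qed

text \<open>Induction on the 2-adic valuation \<open>j\<close> of register 4: each pass halves that
  register and squares register 1, and the loop stops once register 4 is odd, hence after
  \<open>j\<close> squarings.\<close>

lemma exec_square_loop:
  assumes "s 4 = 2 ^ j * d" "odd d" "d > 0" "s 4 \<le> s 0" "0 \<le> s 1" "s 1 < s 0"
    and "s 2 = 2" "s 3 = 1" "s 5 = 1 - s 4 mod 2"
  shows "\<exists>t s'. exec orc (While 5 square_body) s t s' \<and> s' 0 = s 0 \<and>
    s' 1 = s 1 ^ (2 ^ j) mod s 0 \<and> t \<le> 2 + j * (15 * bit_size (s 0) ^ 2)"
  using assms
proof (induction j arbitrary: s)
  case 0
  then have "s 5 = 0" by (simp add: mod_2_eq_odd)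
  then have "exec orc (While 5 square_body) s (bit_size (s 5)) s" by (intro exec.WhileFalse) simp
  moreover have "bit_size (s 5) \<le> 2" using \<open>s 5 = 0\<close> by (intro bit_size_le_2) simp
  ultimately show ?case using 0 by force
next
  case (Suc j)
  define s1 where "s1 = s(1 := s 1 * s 1 mod s 0, 4 := s 4 div 2, 5 := 1 - s 4 div 2 mod 2)"
  have s5: "s 5 = 1" using Suc.prems by simp
  have pos: "s 4 \<ge> 0" using Suc.prems by simp
  obtain t1 where t1: "exec orc square_body s t1 s1" "t1 \<le> 13 * bit_size (s 0) ^ 2"
    using exec_square_body[of s orc] Suc.prems pos unfolding s1_def by blast
  have "\<exists>t s'. exec orc (While 5 square_body) s1 t s' \<and> s' 0 = s1 0 \<and>
    s' 1 = s1 1 ^ (2 ^ j) mod s1 0 \<and> t \<le> 2 + j * (15 * bit_size (s1 0) ^ 2)"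
    using Suc.prems pos by (intro Suc.IH) (auto simp: s1_def)
  then obtain t2 s2 where t2: "exec orc (While 5 square_body) s1 t2 s2" "s2 0 = s 0"
    "s2 1 = (s 1 * s 1 mod s 0) ^ (2 ^ j) mod s 0" "t2 \<le> 2 + j * (15 * bit_size (s 0) ^ 2)"
    by (auto simp: s1_def)
  have "exec orc (While 5 square_body) s (bit_size (s 5) + t1 + t2) s2"
    using s5 t1 t2 by (intro exec.WhileTrue) auto
  moreover have "s2 1 = s 1 ^ (2 ^ Suc j) mod s 0"
    unfolding t2(3) power_mod by (simp add: power_mult power2_eq_square)
  \<comment> \<open>Each pass costs 13 squared lengths plus at most 2 for the test, hence 15; the
    separate 2 pays for the final failing test.\<close>
  moreover have "bit_size (s 5) + t1 + t2 \<le> 2 + Suc j * (15 * bit_size (s 0) ^ 2)"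
  proof -
    have "bit_size (s 5) \<le> 2" using s5 by (intro bit_size_le_2) simp
    moreover have "bit_size (s 0) ^ 2 \<ge> 1" using bit_size_ge_1[of "s 0"] by simp
    ultimately show ?thesis using t1(2) t2(4) unfolding mult_Suc by linarith
  qed
  ultimately show ?case using t2(2) by blast
qed

lemma exec_reduction:
  assumes "N > 1" "N - 1 = 2 ^ j * d" "odd d"
    and M: "bit_size (int N) \<le> M" "bit_size a \<le> M"
    and v: "v = orc N (nat (a ^ (2 ^ j) mod int N))" "\<bar>v\<bar> \<le> 1"
  shows "\<exists>t s. exec orc reduction (input_state N a) t s \<and> s 0 = (if v > 0 then 1 else 0) \<and>
    t \<le> 38 * M ^ 3"
proof -
  define s where "s = (input_state N a)(2 := 2, 3 := 1, 4 := int N - 1, 1 := a mod int N,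
    5 := 1 - (int N - 1) mod 2)"
  have d: "d > 0" using assms(3) by (simp add: odd_pos)
  have N: "int N - 1 = 2 ^ j * int d"
    using assms(1,2) by (metis int_ops(6) less_imp_le_nat linorder_not_less of_nat_1 of_nat_less_iff
        of_nat_mult of_nat_numeral of_nat_power)
  have s0: "s 0 = int N" and s1: "s 1 = a mod int N"
    by (simp_all add: s_def input_state_def)
  have "\<exists>t s'. exec orc (While 5 square_body) s t s' \<and> s' 0 = s 0 \<and>
    s' 1 = s 1 ^ (2 ^ j) mod s 0 \<and> t \<le> 2 + j * (15 * bit_size (s 0) ^ 2)"
    using assms(1,3) d N
    by (intro exec_square_loop[where d = "int d"]) (auto simp: s_def input_state_def)
  then obtain t1 s' where loop: "exec orc (While 5 square_body) s t1 s'" "s' 0 = int N"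
    "s' 1 = a ^ (2 ^ j) mod int N" "t1 \<le> 2 + j * (15 * bit_size (int N) ^ 2)"
    unfolding s0 s1 power_mod by blast
  define t0 where "t0 = 3 + (2 + ((bit_size (int N) + 2) + (bit_size a * bit_size (int N)
    + (bit_size (int N - 1) * 3 + (2 + bit_size ((int N - 1) mod 2))))))"
  define t where "t = t0 + (t1 + (1 + (bit_size v + bit_size (if v > 0 then 1 else 0))))"
  have two: "bit_size 2 = 3" by (simp add: bit_size_def bitlen_def floorlog_def)
  have one: "bit_size 1 = 2" by (simp add: bit_size_def bitlen_def floorlog_def)
  have "exec orc (Seq (While 5 square_body) (Seq (Query 5 0 1) (Cond 5 (Load 0 1) (Load 0 0)))) s
     (t1 + (1 + (bit_size v + bit_size (if v > 0 then 1 else 0))))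
     (s'(5 := v, 0 := if v > 0 then 1 else 0))"
    by (rule exec.Seq[OF loop(1)]) (simp add: exec_iff loop v(1)[symmetric] del: One_nat_def)
  moreover have "exec orc setup_regs (input_state N a) t0 s"
    unfolding setup_regs_def t0_def s_def
    by (simp add: exec_iff two one input_state_def fun_upd_twist del: One_nat_def)
  ultimately have "exec orc reduction (input_state N a) t (s'(5 := v, 0 := if v > 0 then 1 else 0))"
    unfolding reduction_def t_def by (blast intro: exec.Seq)
  \<comment> \<open>The setup costs at most \<open>M ^ 2 + 4 * M + 11\<close>, the loop
    \<open>15 * M ^ 3 + 2\<close>, query and answer 5. Bounding every power of \<open>M\<close> by
    \<open>M ^ 3\<close> gives 1 + 4 + 11 + 15 + 2 + 5 = 38.\<close>
  moreover have "t \<le> 38 * M ^ 3"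
  proof -
    have M1: "M \<ge> 1" using M(1) bit_size_ge_1[of "int N"] by linarith
    \<comment> \<open>As \<open>2 ^ j\<close> divides \<open>N - 1\<close>, the number of passes is
      at most the length of \<open>N\<close>.\<close>
    have "2 ^ j * 1 \<le> 2 ^ j * int d" using d by (intro mult_left_mono) auto
    then have "(2::int) ^ j < 2 ^ (bit_size (int N) - 1)"
      using abs_less_power_bit_size[of "int N"] N by linarith
    then have "j \<le> M" using M(1) by (simp add: power_strict_increasing_iff)
    then have "j * (15 * bit_size (int N) ^ 2) \<le> M * (15 * M ^ 2)"
      using M(1) by (intro mult_mono power_mono) auto
    then have t1: "t1 \<le> 2 + 15 * M ^ 3"
      using loop(4) by (simp add: power3_eq_cube power2_eq_square)
    have "bit_size a * bit_size (int N) \<le> M * M" using M by (intro mult_mono) auto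
    then have t2: "bit_size a * bit_size (int N) \<le> M ^ 2" by (simp add: power2_eq_square)
    have "bit_size (int N - 1) \<le> bit_size (int N)" using assms(1) by (intro bit_size_mono) auto
    then have t3: "bit_size (int N - 1) \<le> M" using M(1) by linarith
    have t4: "bit_size ((int N - 1) mod 2) \<le> 2" by (intro bit_size_le_2) auto
    have t5: "bit_size v \<le> 2" using v(2) by (intro bit_size_le_2)
    have t6: "bit_size (if v > 0 then 1 else 0) \<le> 2" by (intro bit_size_le_2) auto
    have pow: "M \<le> M ^ 3" "M ^ 2 \<le> M ^ 3" "1 \<le> M ^ 3"
      using power_increasing[of 1 3 M] power_increasing[of 2 3 M] power_increasing[of 0 3 M] M1 by auto
    show ?thesis using t1 t2 t3 t4 t5 t6 pow M(1) unfolding t_def t0_def by linarith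
  qed
  ultimately show ?thesis by (intro exI[of _ t]) (auto intro!: exI)
qed

text \<open>The oracle is trusted only on valid instances, so the promise for \<open>N\<close> and
  the residue \<open>m\<close> is checked before its answer is used.\<close>

lemma reduction_correct:
  assumes "prime p" "prime q" "N = p * q"
    and neq: "multiplicity 2 (p - 1) \<noteq> multiplicity 2 (q - 1)"
    and cop: "coprime a (int N)" and res: "res_symbol 1 a N = 1"
    and orc: "solves_CRS (multiplicity 2 (N - 1) + 1) orc"
    and M: "bit_size (int N) \<le> M" "bit_size a \<le> M"
  shows "\<exists>t s. exec orc reduction (input_state N a) t s \<and>
    s 0 = (if QuadRes (int N) a then 1 else 0) \<and> t \<le> 38 * M ^ 3"
proof -
  define j where "j = multiplicity 2 (N - 1)"
  define m where "m = nat (a ^ (2 ^ j) mod int N)"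
  have "p > 1" "q > 1" using assms(1,2) prime_gt_1_nat by auto
  then have N: "N > 1" unfolding assms(3) by (metis less_1_mult)
  obtain d where d: "N - 1 = 2 ^ j * d" "odd d"
    using multiplicity_decompose'[of "N - 1" 2] N unfolding j_def by auto
  have m: "int m = a ^ (2 ^ j) mod int N" using N by (simp add: m_def)
  then have mcong: "[int m = a ^ (2 ^ j)] (mod int N)" by simp
  have "coprime (int m) (int N)"
    using mcong cop by (metis cong_imp_coprime cong_sym coprime_power_left_iff)
  then have "coprime N m" by (simp add: coprime_commute)
  moreover have "m > 0" using \<open>coprime N m\<close> N by (cases "m = 0") auto
  \<comment> \<open>The promise holds because \<open>a\<close> itself is a \<open>2 ^ j\<close>-th
    root of \<open>m\<close> modulo every prime factor.\<close>
  moreover have "prime_symbol j (int m) r = 1" if "r \<in> prime_factors N" for r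
  proof -
    have "[int m = a ^ (2 ^ j)] (mod int r)"
      using mcong that by (meson cong_dvd_modulus in_prime_factors_imp_dvd int_dvd_int_iff)
    then show ?thesis by (simp add: prime_symbol_cong)
  qed
  ultimately have "CRS_instance (j + 1) N m" using N by (simp add: CRS_instance_def)
  then have "orc N m = res_symbol (Suc j) (int m) N"
    using orc by (simp add: solves_CRS_def j_def)
  also have "\<dots> = res_symbol (Suc j) (a ^ (2 ^ j)) N" using mcong by (rule res_symbol_cong)
  also have "\<dots> = (if QuadRes (int N) a then 1 else -1)"
  \<comment> \<open>The argument is symmetric in the primes, so the one with the smaller valuation
    may take the role of \<open>p\<close>.\<close>
  proof (cases "multiplicity 2 (p - 1) < multiplicity 2 (q - 1)")
    case True
    then show ?thesis using CRS_answer_iff_QuadRes[of p q a j] assms j_def by simp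
  next
    case False
    then have "multiplicity 2 (q - 1) < multiplicity 2 (p - 1)" using neq by simp
    then show ?thesis
      using CRS_answer_iff_QuadRes[of q p a j] assms j_def by (simp add: mult.commute)
  qed
  finally have v: "orc N m = (if QuadRes (int N) a then 1 else -1)" .
  show ?thesis
    using exec_reduction[OF N d M refl, of orc] v unfolding m_def[symmetric]
    by (auto split: if_splits)
qed

text \<open>Program and polynomial are fixed before the primes, the input and the oracle, so the
  reduction is uniform. Reading an arbitrary \<open>a\<close> costs time depending on its length;
  for \<bar>a\<bar> < N a bound in the length of \<open>N\<close> alone is possible.\<close>

theorem theorem3:
  shows "\<exists>(prog :: com) (P :: real poly).
    \<forall>(p :: nat) (q :: nat) (N :: nat) (a :: int) (orc :: nat \<Rightarrow> nat \<Rightarrow> int).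
      prime p \<and> prime q \<and> N = p * q \<and>
      multiplicity 2 (p - 1) \<noteq> multiplicity 2 (q - 1) \<and>
      coprime a (int N) \<and> res_symbol 1 a N = 1 \<and>
      solves_CRS (multiplicity 2 (N - 1) + 1) orc
      \<longrightarrow>
      (\<exists>(t :: nat) (s :: state).
         exec orc prog (input_state N a) t s \<and>
         s 0 = (if QuadRes (int N) a then 1 else 0) \<and>
         real t \<le> poly P (log 2 (real N) + log 2 (1 + \<bar>real_of_int a\<bar>)) \<and>
         (\<bar>a\<bar> < int N \<longrightarrow> real t \<le> poly P (log 2 (real N))))"
\<comment> \<open>The polynomial is 38 (x + 2)^3, where x + 2 bounds the input lengths by
  logarithms.\<close>
proof (intro exI[of _ reduction] exI[of _ "smult 38 ([:2, 1:] ^ 3)"] allI impI, elim conjE)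
  fix p q N :: nat and a :: int and orc :: "nat \<Rightarrow> nat \<Rightarrow> int"
  assume A: "prime p" "prime q" "N = p * q" "multiplicity 2 (p - 1) \<noteq> multiplicity 2 (q - 1)"
    "coprime a (int N)" "res_symbol 1 a N = 1" "solves_CRS (multiplicity 2 (N - 1) + 1) orc"
  define M where "M = max (bit_size (int N)) (bit_size a)"
  obtain t s where ts: "exec orc reduction (input_state N a) t s"
    "s 0 = (if QuadRes (int N) a then 1 else 0)" "t \<le> 38 * M ^ 3"
    using reduction_correct[OF A, of M] by (auto simp: M_def)
  have N: "N > 0" using A(1-3) prime_gt_0_nat by simp
  have bound: "real t \<le> poly (smult 38 ([:2, 1:] ^ 3)) x" if x: "real M \<le> x + 2" for x
  proof -
    have "real t \<le> real (38 * M ^ 3)" using ts(3) by (rule of_nat_mono)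
    also have "\<dots> \<le> 38 * (x + 2) ^ 3" using x by (simp add: power_mono)
    finally show ?thesis by (simp add: add.commute)
  qed
  have "0 \<le> log 2 (real N)" "0 \<le> log 2 (1 + \<bar>real_of_int a\<bar>)" using N by simp_all
  then have "real M \<le> log 2 (real N) + log 2 (1 + \<bar>real_of_int a\<bar>) + 2"
    using bit_size_le_log'[OF N] bit_size_le_log[of a] unfolding M_def of_nat_max by linarith
  moreover have "real M \<le> log 2 (real N) + 2" if "\<bar>a\<bar> < int N"
    using bit_size_le_log'[OF N] bit_size_mono[of a "int N"] that unfolding M_def by simp
  ultimately show "\<exists>t s. exec orc reduction (input_state N a) t s \<and>
      s 0 = (if QuadRes (int N) a then 1 else 0) \<and>
      real t \<le> poly (smult 38 ([:2, 1:] ^ 3)) (log 2 (real N) + log 2 (1 + \<bar>real_of_int a\<bar>)) \<and>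
      (\<bar>a\<bar> < int N \<longrightarrow> real t \<le> poly (smult 38 ([:2, 1:] ^ 3)) (log 2 (real N)))"
    using ts(1,2) bound by blast
qed

end
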